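(* There exists a closed subspace $Z$ of $C[0,1]$ whose dual $Z^*$ is separable such that the quotient space $C[0,1]/Z$ does not have the Daugavet property.
   Context: $C[0,1]$ is the real Banach space of continuous functions on $[0,1]$ with the supremum norm, and quotients carry the quotient norm. A normed space $X$ has the Daugavet property if $\|\mathrm{Id} + T\| = 1 + \|T\|$ for every (bounded linear) rank-one operator $T \colon X \to X$. *)

theory Defs
  imports "HOL-Analysis.Analysis"
begin

text \<open>The unit interval as a metric space of its own, so that C[0,1] is an instance of the
  library type of bounded continuous functions with the supremum norm.\<close>

typedef unit_interval = "{0..1::real}"
  morphisms real_of_unit unit_of_real
  by (rule exI[of _ 0]) simp

instantiation unit_interval :: metric_space
begin

definition dist_unit_interval :: "unit_interval \<Rightarrow> unit_interval \<Rightarrow> real"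
  where "dist_unit_interval s t = dist (real_of_unit s) (real_of_unit t)"

definition uniformity_unit_interval :: "(unit_interval \<times> unit_interval) filter"
  where "uniformity_unit_interval = (INF e\<in>{0 <..}. principal {(s, t). dist s t < e})"

definition open_unit_interval :: "unit_interval set \<Rightarrow> bool"
  where "open_unit_interval U \<longleftrightarrow> (\<forall>s\<in>U. \<forall>\<^sub>F (s', t) in uniformity. s' = s \<longrightarrow> t \<in> U)"

instance
proof
  show "dist s t = 0 \<longleftrightarrow> s = t" for s t :: unit_interval
    by (simp add: dist_unit_interval_def real_of_unit_inject)
  show "dist s t \<le> dist s u + dist t u" for s t u :: unit_interval
    unfolding dist_unit_interval_def by (rule dist_triangle2)
qed (simp_all add: uniformity_unit_interval_def open_unit_interval_def)

end

type_synonym C01 = "unit_interval \<Rightarrow>\<^sub>C real"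

lemma continuous_on_real_of_unit: "continuous_on A real_of_unit"
  by (auto simp: continuous_on_iff dist_unit_interval_def)

lemma continuous_on_unit_of_real: "continuous_on {0..1} unit_of_real"
  by (auto simp: continuous_on_iff dist_unit_interval_def unit_of_real_inverse)

lemma compact_UNIV_unit_interval: "compact (UNIV :: unit_interval set)"
proof -
  have "UNIV = unit_of_real ` {0..1}"
    using type_definition.Abs_image[OF type_definition_unit_interval] by simp
  then show ?thesis
    by (metis compact_continuous_image compact_Icc continuous_on_unit_of_real)
qed

text \<open>All continuous functions on the interval arise: the boundedness required by the type
  is automatic.\<close>

lemma C01_continuous_on: "continuous_on {0..1} (\<lambda>t. apply_bcontfun (f :: C01) (unit_of_real t))"
  by (rule continuous_on_compose2[OF _ continuous_on_unit_of_real, of UNIV]) auto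

lemma C01_exists:
  assumes "continuous_on {0..1} (g :: real \<Rightarrow> real)"
  shows "\<exists>f :: C01. \<forall>t\<in>{0..1}. apply_bcontfun f (unit_of_real t) = g t"
proof -
  have "continuous_on UNIV (\<lambda>s. g (real_of_unit s))"
    by (rule continuous_on_compose2[OF assms continuous_on_real_of_unit])
       (use real_of_unit in auto)
  moreover from this have "bounded (range (\<lambda>s. g (real_of_unit s)))"
    using compact_UNIV_unit_interval compact_continuous_image compact_imp_bounded by blast
  ultimately have "(\<lambda>s. g (real_of_unit s)) \<in> bcontfun"
    by (simp add: bcontfun_def)
  then show ?thesis
    by (intro exI[of _ "Bcontfun (\<lambda>s. g (real_of_unit s))"])
       (auto simp: Bcontfun_inverse unit_of_real_inverse)
qed

text \<open>A closed subspace that is not fixed in advance, its dual and the quotient by it are not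
  types; they are represented by records.\<close>

record 'a nspace =
  ns_carrier :: "'a set"
  ns_add :: "'a \<Rightarrow> 'a \<Rightarrow> 'a"
  ns_scale :: "real \<Rightarrow> 'a \<Rightarrow> 'a"
  ns_zero :: 'a
  ns_norm :: "'a \<Rightarrow> real"

locale normed_space_on =
  fixes X :: "'a nspace"
  assumes add_closed: "x \<in> ns_carrier X \<Longrightarrow> y \<in> ns_carrier X \<Longrightarrow> ns_add X x y \<in> ns_carrier X"
    and scale_closed: "x \<in> ns_carrier X \<Longrightarrow> ns_scale X c x \<in> ns_carrier X"
    and zero_closed: "ns_zero X \<in> ns_carrier X"
    and add_assoc: "x \<in> ns_carrier X \<Longrightarrow> y \<in> ns_carrier X \<Longrightarrow> z \<in> ns_carrier X \<Longrightarrow>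
      ns_add X (ns_add X x y) z = ns_add X x (ns_add X y z)"
    and add_commute: "x \<in> ns_carrier X \<Longrightarrow> y \<in> ns_carrier X \<Longrightarrow> ns_add X x y = ns_add X y x"
    and zero_add: "x \<in> ns_carrier X \<Longrightarrow> ns_add X (ns_zero X) x = x"
    and add_neg: "x \<in> ns_carrier X \<Longrightarrow> ns_add X x (ns_scale X (-1) x) = ns_zero X"
    and scale_add: "x \<in> ns_carrier X \<Longrightarrow> y \<in> ns_carrier X \<Longrightarrow>
      ns_scale X c (ns_add X x y) = ns_add X (ns_scale X c x) (ns_scale X c y)"
    and add_scale: "x \<in> ns_carrier X \<Longrightarrow>
      ns_scale X (c + d) x = ns_add X (ns_scale X c x) (ns_scale X d x)"
    and scale_scale: "x \<in> ns_carrier X \<Longrightarrow> ns_scale X c (ns_scale X d x) = ns_scale X (c * d) x"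
    and scale_one: "x \<in> ns_carrier X \<Longrightarrow> ns_scale X 1 x = x"
    and norm_nonneg: "x \<in> ns_carrier X \<Longrightarrow> ns_norm X x \<ge> 0"
    and norm_eq_0: "x \<in> ns_carrier X \<Longrightarrow> ns_norm X x = 0 \<longleftrightarrow> x = ns_zero X"
    and norm_triangle: "x \<in> ns_carrier X \<Longrightarrow> y \<in> ns_carrier X \<Longrightarrow>
      ns_norm X (ns_add X x y) \<le> ns_norm X x + ns_norm X y"
    and norm_scale: "x \<in> ns_carrier X \<Longrightarrow> ns_norm X (ns_scale X c x) = \<bar>c\<bar> * ns_norm X x"

text \<open>The value 0 off the carrier serves the library locale of metric spaces, which wants
  symmetry and nonnegativity on the whole type.\<close>

definition ns_dist :: "'a nspace \<Rightarrow> 'a \<Rightarrow> 'a \<Rightarrow> real" where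
  "ns_dist X x y = (if x \<in> ns_carrier X \<and> y \<in> ns_carrier X
     then ns_norm X (ns_add X x (ns_scale X (-1) y)) else 0)"

definition ns_topology :: "'a nspace \<Rightarrow> 'a topology" where
  "ns_topology X = Metric_space.mtopology (ns_carrier X) (ns_dist X)"

definition bounded_linear_on :: "'a nspace \<Rightarrow> 'b nspace \<Rightarrow> ('a \<Rightarrow> 'b) \<Rightarrow> bool" where
  "bounded_linear_on X Y T \<longleftrightarrow>
     (\<forall>x\<in>ns_carrier X. T x \<in> ns_carrier Y) \<and>
     (\<forall>x\<in>ns_carrier X. \<forall>y\<in>ns_carrier X. T (ns_add X x y) = ns_add Y (T x) (T y)) \<and>
     (\<forall>c. \<forall>x\<in>ns_carrier X. T (ns_scale X c x) = ns_scale Y c (T x)) \<and>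
     (\<exists>K. \<forall>x\<in>ns_carrier X. ns_norm Y (T x) \<le> K * ns_norm X x)"

definition op_norm :: "'a nspace \<Rightarrow> 'b nspace \<Rightarrow> ('a \<Rightarrow> 'b) \<Rightarrow> real" where
  "op_norm X Y T = (SUP x\<in>{x \<in> ns_carrier X. ns_norm X x \<le> 1}. ns_norm Y (T x))"

definition rank_one :: "'a nspace \<Rightarrow> 'b nspace \<Rightarrow> ('a \<Rightarrow> 'b) \<Rightarrow> bool" where
  "rank_one X Y T \<longleftrightarrow>
     (\<exists>y\<in>ns_carrier Y. y \<noteq> ns_zero Y \<and> T ` ns_carrier X = range (\<lambda>c. ns_scale Y c y))"

definition daugavet_property :: "'a nspace \<Rightarrow> bool" where
  "daugavet_property X \<longleftrightarrow>
     (\<forall>T. bounded_linear_on X X T \<and> rank_one X X T \<longrightarrow>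
        op_norm X X (\<lambda>x. ns_add X x (T x)) = 1 + op_norm X X T)"

definition subspace_nspace :: "'a::real_normed_vector set \<Rightarrow> 'a nspace" where
  "subspace_nspace Z =
     \<lparr>ns_carrier = Z, ns_add = (+), ns_scale = scaleR, ns_zero = 0, ns_norm = norm\<rparr>"

text \<open>Functionals are extensional, so that functions agreeing on the carrier are identified.\<close>

definition dual_nspace :: "'a nspace \<Rightarrow> ('a \<Rightarrow> real) nspace" where
  "dual_nspace X =
     \<lparr>ns_carrier = {f. bounded_linear_on X (subspace_nspace UNIV) f} \<inter> extensional (ns_carrier X),
      ns_add = (\<lambda>f g. \<lambda>x\<in>ns_carrier X. f x + g x),
      ns_scale = (\<lambda>c f. \<lambda>x\<in>ns_carrier X. c * f x),
      ns_zero = (\<lambda>x\<in>ns_carrier X. 0),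
      ns_norm = op_norm X (subspace_nspace UNIV)\<rparr>"

text \<open>Elements are the cosets \<open>x + Z\<close>. Adding \<open>Z\<close> in the scalar multiple
  only matters for the scalar 0.\<close>

definition quotient_nspace :: "'a::real_normed_vector set \<Rightarrow> 'a set nspace" where
  "quotient_nspace Z =
     \<lparr>ns_carrier = range (\<lambda>x. (+) x ` Z),
      ns_add = (\<lambda>A B. {a + b | a b. a \<in> A \<and> b \<in> B}),
      ns_scale = (\<lambda>c A. {c *\<^sub>R a + z | a z. a \<in> A \<and> z \<in> Z}),
      ns_zero = Z,
      ns_norm = (\<lambda>A. INF a\<in>A. norm a)\<rparr>"

lemma (in normed_space_on) Metric_space_ns_dist: "Metric_space (ns_carrier X) (ns_dist X)"
proof -
  let ?d = "\<lambda>x y. ns_add X x (ns_scale X (-1) y)"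
  have neg: "ns_scale X (-1) (?d x y) = ?d y x" if "x \<in> ns_carrier X" "y \<in> ns_carrier X" for x y
    using that by (simp add: scale_add scale_closed scale_scale scale_one add_commute)
  have add: "ns_add X (?d x y) (?d y z) = ?d x z"
    if "x \<in> ns_carrier X" "y \<in> ns_carrier X" "z \<in> ns_carrier X" for x y z
  proof -
    have "ns_add X (?d x y) (?d y z)
        = ns_add X x (ns_add X (ns_add X (ns_scale X (-1) y) y) (ns_scale X (-1) z))"
      using that by (simp add: add_assoc add_closed scale_closed)
    also have "ns_add X (ns_scale X (-1) y) y = ns_zero X"
      using that by (simp add: add_commute scale_closed add_neg)
    finally show ?thesis using that by (simp add: zero_add scale_closed)
  qed
  have eq: "?d x y = ns_zero X \<longleftrightarrow> x = y" if "x \<in> ns_carrier X" "y \<in> ns_carrier X" for x y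
  proof
    assume *: "?d x y = ns_zero X"
    have "x = ns_add X x (ns_add X (ns_scale X (-1) y) y)"
      using that
      by (metis add_commute add_neg scale_closed zero_add zero_closed)
    also have "\<dots> = ns_add X (?d x y) y"
      using that by (simp add: add_assoc scale_closed)
    finally show "x = y" using that * by (simp add: zero_add)
  qed (use that add_neg in auto)
  show ?thesis
  proof
    show "0 \<le> ns_dist X x y" for x y
      by (simp add: ns_dist_def norm_nonneg add_closed scale_closed)
    show "ns_dist X x y = ns_dist X y x" for x y
      using neg[of x y] norm_scale[of "?d x y" "-1"]
      by (auto simp: ns_dist_def add_closed scale_closed)
    show "ns_dist X x y = 0 \<longleftrightarrow> x = y" if "x \<in> ns_carrier X" "y \<in> ns_carrier X" for x y
      using that eq by (simp add: ns_dist_def norm_eq_0 add_closed scale_closed)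
    show "ns_dist X x z \<le> ns_dist X x y + ns_dist X y z"
      if "x \<in> ns_carrier X" "y \<in> ns_carrier X" "z \<in> ns_carrier X" for x y z
      using that add norm_triangle[of "?d x y" "?d y z"]
      by (simp add: ns_dist_def add_closed scale_closed)
  qed
qed

lemma normed_space_on_subspace:
  assumes "subspace Z"
  shows "normed_space_on (subspace_nspace Z)"
  using assms
  by unfold_locales
     (auto simp: subspace_nspace_def subspace_add subspace_scale subspace_0 algebra_simps
       norm_triangle_ineq)

lemma (in normed_space_on) op_norm_bound:
  assumes "bounded_linear_on X (subspace_nspace UNIV) f" and "x \<in> ns_carrier X"
  shows "\<bar>f x :: real\<bar> \<le> op_norm X (subspace_nspace UNIV) f * ns_norm X x"
proof -
  obtain K where K: "\<And>x. x \<in> ns_carrier X \<Longrightarrow> \<bar>f x\<bar> \<le> K * ns_norm X x"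
    using assms unfolding bounded_linear_on_def subspace_nspace_def nspace.simps real_norm_def by blast
  have bdd: "bdd_above ((\<lambda>x. \<bar>f x\<bar>) ` {x \<in> ns_carrier X. ns_norm X x \<le> 1})"
  proof (intro bdd_aboveI2[of _ _ "\<bar>K\<bar>"])
    fix x assume x: "x \<in> {x \<in> ns_carrier X. ns_norm X x \<le> 1}"
    then have "\<bar>f x\<bar> \<le> K * ns_norm X x" using K by auto
    also have "\<dots> \<le> \<bar>K\<bar> * 1"
      using x norm_nonneg[of x] by (intro mult_mono) auto
    finally show "\<bar>f x\<bar> \<le> \<bar>K\<bar>" by simp
  qed
  show ?thesis
  proof (cases "ns_norm X x = 0")
    case True
    then show ?thesis using K[OF assms(2)] by simp
  next
    case False
    define n where "n = ns_norm X x"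
    have n: "n > 0" using False norm_nonneg[OF assms(2)] by (simp add: n_def)
    have "\<bar>f (ns_scale X (1 / n) x)\<bar> \<le> op_norm X (subspace_nspace UNIV) f"
      unfolding op_norm_def using bdd n assms(2)
      by (auto simp: subspace_nspace_def scale_closed norm_scale n_def intro!: cSUP_upper)
    moreover have "f (ns_scale X (1 / n) x) = f x / n"
      using assms by (simp add: bounded_linear_on_def subspace_nspace_def)
    ultimately show ?thesis using n by (simp add: n_def field_simps)
  qed
qed

lemma (in normed_space_on) op_norm_least:
  assumes "\<And>x. x \<in> ns_carrier X \<Longrightarrow> \<bar>f x :: real\<bar> \<le> K * ns_norm X x" and "K \<ge> 0"
  shows "op_norm X (subspace_nspace UNIV) f \<le> K"
  unfolding op_norm_def subspace_nspace_def nspace.simps real_norm_def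
proof (rule cSUP_least)
  show "{x \<in> ns_carrier X. ns_norm X x \<le> 1} \<noteq> {}"
    using zero_closed norm_eq_0[OF zero_closed] by force
  fix x assume x: "x \<in> {x \<in> ns_carrier X. ns_norm X x \<le> 1}"
  then have "\<bar>f x\<bar> \<le> K * ns_norm X x" using assms by auto
  also have "\<dots> \<le> K * 1" using x assms(2) by (intro mult_left_mono) auto
  finally show "\<bar>f x\<bar> \<le> K" by simp
qed

lemma (in normed_space_on) normed_space_on_dual: "normed_space_on (dual_nspace X)"
proof -
  let ?R = "subspace_nspace (UNIV :: real set)"
  let ?N = "op_norm X ?R"
  have zero_in: "ns_norm X (ns_zero X) = 0"
    using norm_eq_0[OF zero_closed] by simp
  have nonneg: "?N f \<ge> 0" if "bounded_linear_on X ?R f" for f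
  proof -
    show ?thesis
    proof (cases "\<exists>x\<in>ns_carrier X. ns_norm X x \<noteq> 0")
      case True
      then obtain x where x: "x \<in> ns_carrier X" "ns_norm X x > 0"
        using norm_nonneg by (metis less_eq_real_def)
      then have "0 \<le> ?N f * ns_norm X x"
        using op_norm_bound[OF that, of x] by linarith
      then show ?thesis using x by (simp add: zero_le_mult_iff)
    next
      case False
      then have "x = ns_zero X" if "x \<in> ns_carrier X" for x
        using norm_eq_0 that by blast
      moreover have "ns_norm X (ns_zero X) \<le> 1" using zero_in by simp
      ultimately have "{x \<in> ns_carrier X. ns_norm X x \<le> 1} = {ns_zero X}"
        using zero_closed by blast
      then show ?thesis by (simp add: op_norm_def subspace_nspace_def)
    qed
  qed
  have lin_add: "bounded_linear_on X ?R (\<lambda>x\<in>ns_carrier X. f x + g x)"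
    if f: "bounded_linear_on X ?R f" and g: "bounded_linear_on X ?R g" for f g
  proof -
    have "\<bar>f x + g x\<bar> \<le> (?N f + ?N g) * ns_norm X x" if "x \<in> ns_carrier X" for x
      using op_norm_bound[OF f that] op_norm_bound[OF g that] by (simp add: algebra_simps)
    then have "\<exists>K. \<forall>x\<in>ns_carrier X. \<bar>f x + g x\<bar> \<le> K * ns_norm X x" by blast
    then show ?thesis using f g
      by (simp add: bounded_linear_on_def subspace_nspace_def add_closed scale_closed algebra_simps)
  qed
  have lin_scale: "bounded_linear_on X ?R (\<lambda>x\<in>ns_carrier X. c * f x)"
    if f: "bounded_linear_on X ?R f" for c f
  proof -
    have "\<bar>c * f x\<bar> \<le> (\<bar>c\<bar> * ?N f) * ns_norm X x" if "x \<in> ns_carrier X" for x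
      using op_norm_bound[OF f that] by (simp add: abs_mult mult.assoc mult_left_mono)
    then have "\<exists>K. \<forall>x\<in>ns_carrier X. \<bar>c * f x\<bar> \<le> K * ns_norm X x" by blast
    then show ?thesis using f
      by (simp add: bounded_linear_on_def subspace_nspace_def add_closed scale_closed algebra_simps)
  qed
  have lin_zero: "bounded_linear_on X ?R (\<lambda>x\<in>ns_carrier X. 0)"
    by (auto simp: bounded_linear_on_def subspace_nspace_def add_closed scale_closed intro: exI[of _ 0])
  have scale_le: "?N (\<lambda>x\<in>ns_carrier X. c * f x) \<le> \<bar>c\<bar> * ?N f"
    if f: "bounded_linear_on X ?R f" for c f
    using op_norm_bound[OF f] nonneg[OF f]
    by (intro op_norm_least) (auto simp: abs_mult mult.assoc mult_left_mono)
  have scale_eq: "?N (\<lambda>x\<in>ns_carrier X. c * f x) = \<bar>c\<bar> * ?N f"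
    if f: "bounded_linear_on X ?R f" and "f \<in> extensional (ns_carrier X)" for c f
  proof (cases "c = 0")
    case True
    then show ?thesis using scale_le[OF f, of c] nonneg[OF lin_scale[OF f, of c]] by simp
  next
    case False
    have "(\<lambda>x\<in>ns_carrier X. (1 / c) * (\<lambda>x\<in>ns_carrier X. c * f x) x) = f"
      using that False by (auto simp: extensional_def fun_eq_iff)
    then have "?N f \<le> \<bar>1 / c\<bar> * ?N (\<lambda>x\<in>ns_carrier X. c * f x)"
      using scale_le[OF lin_scale[OF f, of c], of "1 / c"] by simp
    then have "\<bar>c\<bar> * ?N f \<le> ?N (\<lambda>x\<in>ns_carrier X. c * f x)"
      using False by (simp add: field_simps)
    then show ?thesis using scale_le[OF f, of c] by simp
  qed
  show ?thesis
  proof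
    show "ns_norm (dual_nspace X) f = 0 \<longleftrightarrow> f = ns_zero (dual_nspace X)"
      if "f \<in> ns_carrier (dual_nspace X)" for f
    proof
      assume "ns_norm (dual_nspace X) f = 0"
      then show "f = ns_zero (dual_nspace X)"
        using that op_norm_bound[of f]
        by (auto simp: dual_nspace_def extensional_def fun_eq_iff)
    next
      assume "f = ns_zero (dual_nspace X)"
      then show "ns_norm (dual_nspace X) f = 0"
        using op_norm_least[of "\<lambda>x\<in>ns_carrier X. 0" 0] nonneg[OF lin_zero]
        by (simp add: dual_nspace_def)
    qed
    show "ns_norm (dual_nspace X) (ns_add (dual_nspace X) f g)
        \<le> ns_norm (dual_nspace X) f + ns_norm (dual_nspace X) g"
      if "f \<in> ns_carrier (dual_nspace X)" "g \<in> ns_carrier (dual_nspace X)" for f g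
    proof -
      have fg: "bounded_linear_on X ?R f" "bounded_linear_on X ?R g"
        using that by (auto simp: dual_nspace_def)
      have "\<bar>f x + g x\<bar> \<le> (?N f + ?N g) * ns_norm X x" if "x \<in> ns_carrier X" for x
        using op_norm_bound[OF fg(1) that] op_norm_bound[OF fg(2) that]
        by (simp add: algebra_simps)
      then show ?thesis using nonneg[OF fg(1)] nonneg[OF fg(2)]
        by (simp add: dual_nspace_def op_norm_least)
    qed
  qed (auto simp: dual_nspace_def lin_add lin_scale lin_zero nonneg scale_eq
      extensional_def fun_eq_iff algebra_simps)
qed

lemma normed_space_on_quotient:
  fixes Z :: "'a::real_normed_vector set"
  assumes Z: "subspace Z" and closed: "closed Z"
  shows "normed_space_on (quotient_nspace Z)"
proof -
  let ?Q = "quotient_nspace Z"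
  define q where "q = (\<lambda>x. (+) x ` Z)"
  have mem: "y \<in> q x \<longleftrightarrow> y - x \<in> Z" for x y
    by (auto simp: q_def image_iff algebra_simps intro!: bexI[of _ "y - x"])
  have carr: "ns_carrier ?Q = range q" by (simp add: quotient_nspace_def q_def)
  have add: "ns_add ?Q (q x) (q y) = q (x + y)" for x y
  proof (intro set_eqI iffI)
    fix u assume "u \<in> ns_add ?Q (q x) (q y)"
    then obtain a b where "u = (x + a) + (y + b)" "a \<in> Z" "b \<in> Z"
      by (auto simp: quotient_nspace_def q_def)
    then show "u \<in> q (x + y)"
      using subspace_add[OF Z, of a b] by (auto simp: mem algebra_simps)
  next
    fix u assume "u \<in> q (x + y)"
    then obtain z where "u = (x + z) + (y + 0)" "z \<in> Z" by (auto simp: q_def algebra_simps)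
    then show "u \<in> ns_add ?Q (q x) (q y)"
      using subspace_0[OF Z] unfolding quotient_nspace_def nspace.simps q_def by blast
  qed
  have scale: "ns_scale ?Q c (q x) = q (c *\<^sub>R x)" for c x
  proof (intro set_eqI iffI)
    fix u assume "u \<in> ns_scale ?Q c (q x)"
    then obtain a b where "u = c *\<^sub>R (x + a) + b" "a \<in> Z" "b \<in> Z"
      by (auto simp: quotient_nspace_def q_def)
    then show "u \<in> q (c *\<^sub>R x)"
      using subspace_add[OF Z subspace_scale[OF Z], of a b c] by (auto simp: mem algebra_simps)
  next
    fix u assume "u \<in> q (c *\<^sub>R x)"
    then obtain z where "u = c *\<^sub>R (x + 0) + z" "z \<in> Z" by (auto simp: q_def)
    then show "u \<in> ns_scale ?Q c (q x)"
      using subspace_0[OF Z] unfolding quotient_nspace_def nspace.simps q_def by blast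
  qed
  have zero: "ns_zero ?Q = q 0" by (simp add: quotient_nspace_def q_def)
  have bdd: "bdd_below (norm ` A)" for A :: "'a set" by (rule bdd_belowI2[of _ 0]) simp
  have norm: "ns_norm ?Q (q x) = (INF a\<in>q x. norm a)" for x
    by (simp add: quotient_nspace_def)
  have ne: "q x \<noteq> {}" for x using subspace_0[OF Z] by (auto simp: q_def)
  have norm_le: "ns_norm ?Q (q x) \<le> norm a" if "a - x \<in> Z" for a x
    unfolding norm by (rule cINF_lower[OF bdd]) (use that mem in auto)
  have norm_ge: "m \<le> ns_norm ?Q (q x)" if "\<And>a. a - x \<in> Z \<Longrightarrow> m \<le> norm a" for m x
    unfolding norm by (rule cINF_greatest[OF ne]) (use that mem in auto)
  have norm_ex: "\<exists>a. a - x \<in> Z \<and> norm a < ns_norm ?Q (q x) + e" if "e > 0" for x e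
    using norm_ge[of x "ns_norm ?Q (q x) + e"] that by force
  have nonneg: "ns_norm ?Q (q x) \<ge> 0" for x by (rule norm_ge) simp
  have scale_le: "ns_norm ?Q (q (c *\<^sub>R x)) \<le> \<bar>c\<bar> * ns_norm ?Q (q x)" for c x
  proof (cases "c = 0")
    case True
    then show ?thesis using norm_le[of 0 0] subspace_0[OF Z] by simp
  next
    case False
    have "ns_norm ?Q (q (c *\<^sub>R x)) / \<bar>c\<bar> \<le> ns_norm ?Q (q x)"
    proof (rule norm_ge)
      fix a assume "a - x \<in> Z"
      then have "c *\<^sub>R a - c *\<^sub>R x \<in> Z"
        using subspace_scale[OF Z, of "a - x" c] by (simp add: algebra_simps)
      from norm_le[OF this] False
      show "ns_norm ?Q (q (c *\<^sub>R x)) / \<bar>c\<bar> \<le> norm a" by (simp add: field_simps)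
    qed
    then show ?thesis using False by (simp add: field_simps)
  qed
  have scale_eq: "ns_norm ?Q (q (c *\<^sub>R x)) = \<bar>c\<bar> * ns_norm ?Q (q x)" for c x
  proof (cases "c = 0")
    case True
    then show ?thesis using scale_le[of c x] nonneg[of "c *\<^sub>R x"] by simp
  next
    case False
    then show ?thesis using scale_le[of c x] scale_le[of "1 / c" "c *\<^sub>R x"]
      by (simp add: field_simps)
  qed
  have triangle: "ns_norm ?Q (q (x + y)) \<le> ns_norm ?Q (q x) + ns_norm ?Q (q y)" for x y
  proof (rule field_le_epsilon)
    fix e :: real assume "e > 0"
    then obtain a b where a: "a - x \<in> Z" "norm a < ns_norm ?Q (q x) + e / 2"
      and b: "b - y \<in> Z" "norm b < ns_norm ?Q (q y) + e / 2"
      using norm_ex[of "e / 2" x] norm_ex[of "e / 2" y] by auto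
    have "(a + b) - (x + y) \<in> Z"
      using subspace_add[OF Z a(1) b(1)] by (simp add: algebra_simps)
    from norm_le[OF this] a b norm_triangle_ineq[of a b]
    show "ns_norm ?Q (q (x + y)) \<le> ns_norm ?Q (q x) + ns_norm ?Q (q y) + e" by simp
  qed
  have eq_0: "ns_norm ?Q (q x) = 0 \<longleftrightarrow> q x = q 0" for x
  proof
    assume *: "ns_norm ?Q (q x) = 0"
    have "x \<in> closure Z"
    proof (unfold closure_approachable, intro allI impI)
      fix e :: real assume "e > 0"
      then obtain a where a: "a - x \<in> Z" "norm a < e" using norm_ex[of e x] * by auto
      have "x - a \<in> Z" using subspace_neg[OF Z a(1)] by simp
      then show "\<exists>y\<in>Z. dist y x < e" using a by (intro bexI[of _ "x - a"]) (auto simp: dist_norm)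
    qed
    then have x: "x \<in> Z" using closed by simp
    show "q x = q 0"
    proof (intro set_eqI)
      fix u show "u \<in> q x \<longleftrightarrow> u \<in> q 0"
        unfolding mem using x subspace_add[OF Z, of "u - x" x] subspace_diff[OF Z, of u x] by auto
    qed
  next
    assume "q x = q 0"
    then show "ns_norm ?Q (q x) = 0"
      using norm_le[of 0 0] subspace_0[OF Z] nonneg[of 0] by simp
  qed
  show ?thesis
  proof
    fix x y assume "x \<in> ns_carrier ?Q" "y \<in> ns_carrier ?Q"
    then obtain u v where "x = q u" "y = q v" using carr by auto
    then show "ns_add ?Q x y \<in> ns_carrier ?Q" "ns_add ?Q x y = ns_add ?Q y x"
      "ns_norm ?Q (ns_add ?Q x y) \<le> ns_norm ?Q x + ns_norm ?Q y"
      by (simp_all only: carr add triangle rangeI add.commute)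
    show "ns_scale ?Q c (ns_add ?Q x y) = ns_add ?Q (ns_scale ?Q c x) (ns_scale ?Q c y)" for c
      using \<open>x = q u\<close> \<open>y = q v\<close> by (simp only: add scale scaleR_add_right)
  next
    fix x y z assume "x \<in> ns_carrier ?Q" "y \<in> ns_carrier ?Q" "z \<in> ns_carrier ?Q"
    then show "ns_add ?Q (ns_add ?Q x y) z = ns_add ?Q x (ns_add ?Q y z)"
      by (auto simp only: carr add add.assoc image_iff)
  next
    show "ns_zero ?Q \<in> ns_carrier ?Q" by (simp only: zero carr rangeI)
  next
    fix x c d assume "x \<in> ns_carrier ?Q"
    then obtain u where x: "x = q u" using carr by auto
    show "ns_scale ?Q c x \<in> ns_carrier ?Q" by (simp only: x scale carr rangeI)
    show "ns_add ?Q (ns_zero ?Q) x = x" by (simp only: x zero add add_0_left)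
    show "ns_add ?Q x (ns_scale ?Q (-1) x) = ns_zero ?Q" by (simp add: x zero add scale)
    show "ns_scale ?Q (c + d) x = ns_add ?Q (ns_scale ?Q c x) (ns_scale ?Q d x)"
      by (simp only: x add scale scaleR_add_left)
    show "ns_scale ?Q c (ns_scale ?Q d x) = ns_scale ?Q (c * d) x"
      by (simp only: x scale scaleR_scaleR)
    show "ns_scale ?Q 1 x = x" by (simp only: x scale scaleR_one)
    show "ns_norm ?Q x \<ge> 0" by (simp only: x nonneg)
    show "ns_norm ?Q x = 0 \<longleftrightarrow> x = ns_zero ?Q" by (simp only: x zero eq_0)
    show "ns_norm ?Q (ns_scale ?Q c x) = \<bar>c\<bar> * ns_norm ?Q x" by (simp only: x scale scale_eq)
  qed
qed

end

theory Submission
  imports Defs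
begin

text \<open>Let \<open>Z\<close> be the closed span of the ramps \<open>r\<^sub>n(t) = max(0, min(1, 2\<^sup>n t - 1))\<close>. The differences
  \<open>r\<^sub>n\<^sub>+\<^sub>1 - r\<^sub>n\<close> are nonnegative, sum to at most 1 and interpolate at the nodes \<open>2\<^sup>-\<^sup>n\<close>, so they
  span an isometric copy of \<open>c\<^sub>0\<close> and the dual of \<open>Z\<close> is a separable \<open>\<ell>\<^sub>1\<close>.
  Evaluation at 0 vanishes on \<open>Z\<close>, so \<open>T[g] = -g(0)[1]\<close> is a well-defined rank-one operator on the
  quotient. Since \<open>r\<^sub>n\<close> is 1 outside a small neighbourhood of 0, the representative
  \<open>g - g(0) + g(0) r\<^sub>n\<close> of \<open>[g] + T[g]\<close> has norm at most \<open>\<parallel>g\<parallel> + \<epsilon>\<close>. Hence \<open>Id + T\<close> has norm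
  at most 1, although \<open>T\<close> is nonzero.\<close>

section \<open>Ramps, their nodes, and the tents between them\<close>

definition ramp :: "nat \<Rightarrow> C01" where
  "ramp n = Bcontfun (\<lambda>s. max 0 (min 1 (2 ^ n * real_of_unit s - 1)))"

lemma ramp_apply: "ramp n s = max 0 (min 1 (2 ^ n * real_of_unit s - 1))"
proof -
  have "continuous_on UNIV (\<lambda>s. max 0 (min 1 (2 ^ n * real_of_unit s - 1)))"
    by (intro continuous_intros continuous_on_real_of_unit)
  moreover have "bounded (range (\<lambda>s. max 0 (min 1 (2 ^ n * real_of_unit s - 1))))"
    by (auto simp: bounded_iff intro!: exI[of _ 1])
  ultimately show ?thesis
    by (simp add: ramp_def bcontfun_def Bcontfun_inverse)
qed

definition node :: "nat \<Rightarrow> unit_interval" where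
  "node k = unit_of_real (1 / 2 ^ k)"

text \<open>By \<open>ramp_node\<close>, a tent is 1 at its own node and 0 at all the others: the
  tents play the role of the unit vectors of \<open>c_0\<close>.\<close>

definition tent :: "nat \<Rightarrow> C01" where
  "tent n = ramp (Suc n) - ramp n"

definition ramp_space :: "C01 set" where
  "ramp_space = closure (span (range ramp))"

text \<open>A partial sum of the expansion in tents; the coefficients are values at nodes because
  the tents interpolate there.\<close>

definition interp :: "nat \<Rightarrow> C01 \<Rightarrow> C01" where
  "interp N z = (\<Sum>n<N. z (node n) *\<^sub>R tent n)"

lemma real_of_node: "real_of_unit (node k) = 1 / 2 ^ k"
  by (simp add: node_def unit_of_real_inverse)

lemma real_of_unit_bounds: "0 \<le> real_of_unit s" "real_of_unit s \<le> 1"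
  using real_of_unit[of s] by auto

text \<open>The slope of \<open>ramp 0\<close> would start only at the right endpoint 1. Hence the
  telescoping sum in \<open>sum_tent\<close> has no initial term.\<close>

lemma ramp_0: "ramp 0 = 0"
  by (intro bcontfun_eqI)
     (simp add: ramp_apply max.absorb1 min.coboundedI2 real_of_unit_bounds)

lemma ramp_bounds: "0 \<le> ramp n s" "ramp n s \<le> 1"
  by (simp_all add: ramp_apply)

lemma ramp_mono: "ramp n s \<le> ramp (Suc n) s"
  unfolding ramp_apply using real_of_unit_bounds(1)[of s]
  by (intro max.mono min.mono diff_mono mult_right_mono power_increasing) simp_all

lemma ramp_zero: "ramp n (unit_of_real 0) = 0"
  by (simp add: ramp_apply unit_of_real_inverse)

lemma ramp_eq_1: "2 \<le> 2 ^ n * real_of_unit s \<Longrightarrow> ramp n s = 1"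
  by (simp add: ramp_apply)

text \<open>The ramp vanishes up to \<open>1 / 2 ^ n\<close> and is 1 from \<open>2 / 2 ^ n\<close>
  on, so no node falls strictly inside its slope.\<close>

lemma ramp_node: "ramp n (node k) = of_bool (k < n)"
proof (cases "k < n")
  case True
  then have "(2::real) ^ Suc k \<le> 2 ^ n" by (intro power_increasing) auto
  then have "2 \<le> 2 ^ n * real_of_unit (node k)" by (simp add: real_of_node field_simps)
  then show ?thesis using True by (simp add: ramp_eq_1)
next
  case False
  then have "(2::real) ^ n \<le> 2 ^ k" by (intro power_increasing) auto
  then have "2 ^ n * real_of_unit (node k) - 1 \<le> 0" by (simp add: real_of_node field_simps)
  then show ?thesis using False by (simp add: ramp_apply max.absorb1 min.coboundedI2)
qed

lemma apply_bcontfun_sum: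
  fixes f :: "'a \<Rightarrow> 'b::topological_space \<Rightarrow>\<^sub>C 'c::real_normed_vector"
  shows "(\<Sum>i\<in>A. f i) s = (\<Sum>i\<in>A. f i s)"
  by (induction A rule: infinite_finite_induct) auto

lemma tent_nonneg: "0 \<le> tent n s"
  by (simp add: tent_def ramp_mono)

lemma sum_tent: "(\<Sum>n<N. tent n) = ramp N"
  unfolding tent_def by (simp add: sum_lessThan_telescope ramp_0)

text \<open>At each point the tents are nonnegative weights with sum \<open>ramp N s\<close>, which
  is at most 1, so the weighted sum of the coefficients cannot exceed their common bound.\<close>

lemma norm_sum_tent_le:
  assumes "\<And>n. \<bar>a n\<bar> \<le> c"
  shows "norm (\<Sum>n<N. a n *\<^sub>R tent n) \<le> c"
proof (rule norm_bound)
  fix s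
  have c: "0 \<le> c" using assms[of 0] by linarith
  have "norm ((\<Sum>n<N. a n *\<^sub>R tent n) s) \<le> (\<Sum>n<N. c * tent n s)"
    unfolding apply_bcontfun_sum
    by (rule sum_norm_le) (simp add: abs_mult assms mult_right_mono tent_nonneg)
  also have "\<dots> = c * ramp N s"
    by (simp flip: sum_tent add: apply_bcontfun_sum sum_distrib_left)
  also have "\<dots> \<le> c" using ramp_bounds[of N s] c by (simp add: mult_left_le)
  finally show "norm ((\<Sum>n<N. a n *\<^sub>R tent n) s) \<le> c" .
qed

section \<open>The closed span of the ramps\<close>

lemma subspace_closure:
  fixes S :: "'a::real_normed_vector set"
  assumes "subspace S"
  shows "subspace (closure S)"
  unfolding subspace_def
proof (intro conjI ballI allI)
  show "0 \<in> closure S"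
    using subspace_0[OF assms] closure_subset by blast
  fix x assume "x \<in> closure S"
  then obtain f where f: "\<And>n. f n \<in> S" "f \<longlonglongrightarrow> x"
    unfolding closure_sequential by blast
  show "c *\<^sub>R x \<in> closure S" for c
    unfolding closure_sequential
    by (rule exI[of _ "\<lambda>n. c *\<^sub>R f n"])
       (simp add: f subspace_scale assms tendsto_scaleR)
  fix y assume "y \<in> closure S"
  then obtain g where g: "\<And>n. g n \<in> S" "g \<longlonglongrightarrow> y"
    unfolding closure_sequential by blast
  show "x + y \<in> closure S"
    unfolding closure_sequential
    by (rule exI[of _ "\<lambda>n. f n + g n"])
       (simp add: f g subspace_add assms tendsto_add)
qed

lemma subspace_ramp_space: "subspace ramp_space"
  unfolding ramp_space_def by (intro subspace_closure subspace_span)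

lemma ramp_in: "ramp n \<in> ramp_space"
  unfolding ramp_space_def by (rule subsetD[OF closure_subset]) (simp add: span_base)

lemma tent_in: "tent n \<in> ramp_space"
  unfolding tent_def by (intro subspace_diff subspace_ramp_space ramp_in)

lemma sum_tent_in: "(\<Sum>n<N. a n *\<^sub>R tent n) \<in> ramp_space"
  by (intro subspace_sum subspace_scale subspace_ramp_space tent_in)

lemma ramp_space_zero:
  assumes "z \<in> ramp_space" shows "z (unit_of_real 0) = 0"
proof -
  let ?K = "{z :: C01. z (unit_of_real 0) = 0}"
  \<comment> \<open>This form makes \<open>closed_PiC\<close> applicable to the kernel of evaluation
    at 0.\<close>
  have "?K = PiC {unit_of_real 0} (\<lambda>_. {0})"
    by (auto simp: mem_PiC_iff)
  then have "closed ?K"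
    by (simp add: closed_PiC)
  moreover have "span (range ramp) \<subseteq> ?K"
    by (rule span_minimal) (auto simp: ramp_zero subspace_def)
  ultimately show ?thesis
    using assms closure_minimal unfolding ramp_space_def by blast
qed

section \<open>Interpolation at the nodes\<close>

lemma interp_diff: "interp N (z - w) = interp N z - interp N w"
  by (simp add: interp_def scaleR_diff_left sum_subtractf)

lemma norm_interp_le: "norm (interp N z) \<le> norm z"
  unfolding interp_def using norm_bounded[of z] by (intro norm_sum_tent_le) simp

text \<open>The node values of \<open>ramp m\<close> are 1 for the first \<open>m\<close> nodes and
  0 afterwards, so the interpolant is the telescoping sum of the first \<open>m\<close>
  tents.\<close>

lemma interp_ramp: "m \<le> N \<Longrightarrow> interp N (ramp m) = ramp m"
proof -
  assume "m \<le> N"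
  then have "interp N (ramp m) = (\<Sum>n<m. tent n)"
    unfolding interp_def ramp_node by (intro sum.mono_neutral_cong_right) auto
  then show ?thesis by (simp add: sum_tent)
qed

lemma interp_span:
  assumes "z \<in> span (range ramp)"
  shows "\<forall>\<^sub>F N in sequentially. interp N z = z"
  using assms
proof (induction rule: span_induct_alt)
  case base
  then show ?case by (simp add: interp_def)
next
  case (step c x y)
  then obtain m where x: "x = ramp m" by auto
  show ?case using step.IH eventually_ge_at_top[of m]
  proof eventually_elim
    case (elim N)
    have "interp N (c *\<^sub>R x + y) = c *\<^sub>R interp N x + interp N y"
      by (simp add: interp_def scaleR_add_left sum.distrib scaleR_sum_right)
    then show ?case using elim by (simp add: x interp_ramp)
  qed
qed

text \<open>The operators \<open>interp N\<close> are contractions, uniformly in \<open>N\<close>,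
  and eventually fix each element of the dense span, so convergence extends to the closure.\<close>

lemma interp_tendsto:
  assumes "z \<in> ramp_space"
  shows "(\<lambda>N. interp N z) \<longlonglongrightarrow> z"
proof (rule tendstoI)
  fix e :: real assume "e > 0"
  then obtain w where w: "w \<in> span (range ramp)" "dist w z < e / 2"
    using assms unfolding ramp_space_def closure_approachable by (meson half_gt_zero)
  show "\<forall>\<^sub>F N in sequentially. dist (interp N z) z < e"
    using interp_span[OF w(1)]
  proof eventually_elim
    case (elim N)
    have "norm (interp N z - w) \<le> norm (z - w)"
      using norm_interp_le[of N "z - w"] elim by (simp add: interp_diff)
    then have "dist (interp N z) w < e / 2"
      using w(2) by (simp add: dist_norm norm_minus_commute)
    then show ?case using w(2) dist_triangle[of "interp N z" z w] by linarith
  qed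
qed

section \<open>Separability of the dual\<close>

abbreviation ramp_nspace :: "C01 nspace" where
  "ramp_nspace \<equiv> subspace_nspace ramp_space"

abbreviation ramp_dual :: "(C01 \<Rightarrow> real) nspace" where
  "ramp_dual \<equiv> dual_nspace ramp_nspace"

text \<open>These correspond to the finitely supported rational sequences in \<open>l_1\<close>.
  Indexing by lists of rationals makes the family countable, and the restriction meets the
  extensionality of the dual.\<close>

definition node_functional :: "rat list \<Rightarrow> C01 \<Rightarrow> real" where
  "node_functional qs = restrict (\<lambda>z. \<Sum>n<length qs. of_rat (qs ! n) * apply_bcontfun z (node n)) ramp_space"

lemma node_functional_in: "node_functional qs \<in> ns_carrier ramp_dual"
proof -
  have "\<bar>\<Sum>n<length qs. of_rat (qs ! n) * z (node n)\<bar>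
      \<le> (\<Sum>n<length qs. \<bar>of_rat (qs ! n)\<bar>) * norm z" for z :: C01
  proof -
    have "\<bar>\<Sum>n<length qs. of_rat (qs ! n) * z (node n)\<bar>
        \<le> (\<Sum>n<length qs. \<bar>of_rat (qs ! n)\<bar> * norm z)"
      using norm_bounded[of z]
      by (intro order.trans[OF sum_abs] sum_mono) (simp add: abs_mult mult_left_mono)
    then show ?thesis by (simp add: sum_distrib_right)
  qed
  then show ?thesis
    by (auto simp: dual_nspace_def node_functional_def bounded_linear_on_def subspace_nspace_def
        subspace_add subspace_scale subspace_ramp_space distrib_left sum.distrib
        sum_distrib_left mult.left_commute)
qed

lemma ramp_functional_sum_tent:
  assumes "F \<in> ns_carrier ramp_dual"
  shows "F (\<Sum>n<N. a n *\<^sub>R tent n) = (\<Sum>n<N. a n * F (tent n))"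
proof -
  have F: "\<And>x y. x \<in> ramp_space \<Longrightarrow> y \<in> ramp_space \<Longrightarrow> F (x + y) = F x + F y"
    "\<And>c x. x \<in> ramp_space \<Longrightarrow> F (c *\<^sub>R x) = c * F x"
    using assms by (auto simp: dual_nspace_def bounded_linear_on_def subspace_nspace_def)
  have "F 0 = 0"
    using F(2)[of 0 0] subspace_0[OF subspace_ramp_space] by simp
  then show ?thesis
    by (induction N) (simp_all add: F sum_tent_in tent_in subspace_scale subspace_ramp_space)
qed

lemma ramp_functional_bound:
  assumes "F \<in> ns_carrier ramp_dual" "z \<in> ramp_space"
  shows "\<bar>F z\<bar> \<le> ns_norm ramp_dual F * norm z"
  using normed_space_on.op_norm_bound[OF normed_space_on_subspace[OF subspace_ramp_space], of F z]
    assms by (simp add: dual_nspace_def subspace_nspace_def)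

text \<open>Testing \<open>F\<close> on the tent combination with coefficients
  \<open>sgn (F (tent n))\<close>, which has norm at most 1, bounds every partial sum by the norm of
  \<open>F\<close>.\<close>

lemma summable_functional_tent:
  assumes F: "F \<in> ns_carrier ramp_dual"
  shows "summable (\<lambda>n. \<bar>F (tent n)\<bar>)"
proof (rule summableI_nonneg_bounded)
  fix N
  let ?w = "\<Sum>n<N. sgn (F (tent n)) *\<^sub>R tent n"
  have "(\<Sum>n<N. \<bar>F (tent n)\<bar>) = F ?w"
    by (simp add: ramp_functional_sum_tent[OF F] abs_sgn mult.commute)
  also have "\<dots> \<le> ns_norm ramp_dual F * norm ?w"
    using ramp_functional_bound[OF F sum_tent_in] by (meson abs_le_D1)
  also have "\<dots> \<le> ns_norm ramp_dual F * 1"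
  proof (rule mult_left_mono)
    show "norm ?w \<le> 1" by (rule norm_sum_tent_le) (simp add: sgn_real_def)
    show "0 \<le> ns_norm ramp_dual F"
      by (rule normed_space_on.norm_nonneg[OF normed_space_on.normed_space_on_dual F])
         (rule normed_space_on_subspace[OF subspace_ramp_space])
  qed
  finally show "(\<Sum>n<N. \<bar>F (tent n)\<bar>) \<le> ns_norm ramp_dual F" by simp
qed simp

text \<open>The expansion in tents gives \<open>F z\<close> as the series of
  \<open>F (tent n) * z (node n)\<close>. Half of the error is spent on cutting off the tail, half
  on rounding the remaining coefficients to rationals.\<close>

lemma node_functional_dense:
  assumes F: "F \<in> ns_carrier ramp_dual" and e: "e > 0"
  shows "\<exists>qs. \<forall>z\<in>ramp_space. \<bar>F z - node_functional qs z\<bar> \<le> e * norm z"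
proof -
  define a where "a n = F (tent n)" for n
  obtain N where N: "\<And>m n. m \<ge> N \<Longrightarrow> norm (\<Sum>k\<in>{m..<n}. \<bar>a k\<bar>) < e / 2"
    using summable_functional_tent[OF F] e unfolding summable_Cauchy a_def
    by (meson half_gt_zero)
  \<comment> \<open>The \<open>N\<close> rounding errors add up to at most \<open>e / 2\<close>; the
    \<open>+ 1\<close> keeps the denominator positive when \<open>N\<close> is 0.\<close>
  have "\<exists>q. \<bar>a n - of_rat q\<bar> \<le> e / (2 * (real N + 1))" for n
  proof -
    have "a n - e / (2 * (real N + 1)) < a n" using e by simp
    then obtain q where "a n - e / (2 * (real N + 1)) < of_rat q" "of_rat q < a n"
      using of_rat_dense by blast
    then show ?thesis by (intro exI[of _ q]) simp
  qed
  then obtain q where q: "\<And>n. \<bar>a n - of_rat (q n)\<bar> \<le> e / (2 * (real N + 1))" by metis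
  let ?qs = "map q [0..<N]"
  have "\<bar>F z - node_functional ?qs z\<bar> \<le> e * norm z" if z: "z \<in> ramp_space" for z
  proof -
    define g where "g = (\<Sum>n<N. of_rat (q n) * z (node n))"
    have g: "node_functional ?qs z = g"
      using z by (simp add: node_functional_def g_def)
    have zn: "\<bar>z (node n)\<bar> \<le> norm z" for n
      using norm_bounded[of z "node n"] by simp
    \<comment> \<open>Continuity of \<open>F\<close> along the interpolants reduces the estimate to
      finite sums, with a bound uniform in \<open>M\<close>.\<close>
    have "(\<lambda>M. F (interp M z)) \<longlonglongrightarrow> F z"
    proof (rule Lim_null_comparison[THEN LIM_zero_cancel])
      show "\<forall>\<^sub>F M in sequentially.
          norm (F (interp M z) - F z) \<le> ns_norm ramp_dual F * norm (interp M z - z)"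
      proof (intro always_eventually allI)
        fix M
        have "interp M z \<in> ramp_space" by (simp add: interp_def sum_tent_in)
        moreover from this have "F (interp M z - z) = F (interp M z) - F z"
          using F z subspace_diff[OF subspace_ramp_space, of "interp M z" z]
          by (auto simp: dual_nspace_def bounded_linear_on_def subspace_nspace_def)
             (metis add_diff_cancel diff_add_cancel)
        ultimately show "norm (F (interp M z) - F z) \<le> ns_norm ramp_dual F * norm (interp M z - z)"
          using ramp_functional_bound[OF F subspace_diff[OF subspace_ramp_space, of "interp M z" z]] z
          by simp
      qed
      show "(\<lambda>M. ns_norm ramp_dual F * norm (interp M z - z)) \<longlonglongrightarrow> 0"
        by (intro tendsto_mult_right_zero tendsto_norm_zero LIM_zero interp_tendsto z)
    qed
    then have "(\<lambda>M. \<bar>F (interp M z) - g\<bar>) \<longlonglongrightarrow> \<bar>F z - g\<bar>"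
      by (intro tendsto_intros)
    moreover have "\<bar>F (interp M z) - g\<bar> \<le> e * norm z" if M: "M \<ge> N" for M
    proof -
      have "F (interp M z) = (\<Sum>n<M. a n * z (node n))"
        unfolding interp_def ramp_functional_sum_tent[OF F] by (simp add: a_def mult.commute)
      also have "\<dots> = (\<Sum>n<N. a n * z (node n)) + (\<Sum>n\<in>{N..<M}. a n * z (node n))"
        using sum.atLeastLessThan_concat[of 0 N M "\<lambda>n. a n * z (node n)"] M by (simp add: lessThan_atLeast0)
      finally have "F (interp M z) - g
          = (\<Sum>n<N. (a n - of_rat (q n)) * z (node n)) + (\<Sum>n\<in>{N..<M}. a n * z (node n))"
        by (simp add: g_def left_diff_distrib sum_subtractf)
      also have "\<bar>\<dots>\<bar> \<le> (\<Sum>n<N. e / (2 * (real N + 1)) * norm z) + (\<Sum>n\<in>{N..<M}. \<bar>a n\<bar> * norm z)"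
        unfolding abs_mult
        by (intro order.trans[OF abs_triangle_ineq] add_mono order.trans[OF sum_abs] sum_mono;
            unfold abs_mult; intro mult_mono q zn order.refl)
           (use e in simp_all)
      also have "\<dots> = (real N * (e / (2 * (real N + 1))) + (\<Sum>n\<in>{N..<M}. \<bar>a n\<bar>)) * norm z"
        by (simp add: sum_distrib_right distrib_right)
      also have "\<dots> \<le> (e / 2 + e / 2) * norm z"
        using N[of N M] e by (intro mult_right_mono add_mono) (auto simp: field_simps)
      finally show ?thesis by simp
    qed
    ultimately have "\<bar>F z - g\<bar> \<le> e * norm z"
      by (intro LIMSEQ_le_const2) auto
    then show ?thesis by (simp add: g)
  qed
  then show ?thesis by blast
qed

lemma separable_ramp_dual: "separable_space (ns_topology ramp_dual)"
proof -
  interpret P: normed_space_on ramp_nspace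
    by (rule normed_space_on_subspace[OF subspace_ramp_space])
  interpret D: normed_space_on ramp_dual
    by (rule P.normed_space_on_dual)
  interpret M: Metric_space "ns_carrier ramp_dual" "ns_dist ramp_dual"
    by (rule D.Metric_space_ns_dist)
  have "\<exists>G\<in>range node_functional. G \<in> M.mball F r"
    if F: "F \<in> ns_carrier ramp_dual" and r: "r > 0" for F r
  proof -
    \<comment> \<open>Halving the radius leaves room for the strict inequality of the open ball, as
      \<open>op_norm_least\<close> yields only a weak one.\<close>
    obtain qs where qs: "\<And>z. z \<in> ramp_space \<Longrightarrow> \<bar>F z - node_functional qs z\<bar> \<le> r / 2 * norm z"
      using node_functional_dense[OF F, of "r / 2"] r by auto
    have "ns_dist ramp_dual F (node_functional qs) = op_norm ramp_nspace (subspace_nspace UNIV)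
        (ns_add ramp_dual F (ns_scale ramp_dual (- 1) (node_functional qs)))"
      by (simp add: ns_dist_def F node_functional_in) (simp add: dual_nspace_def)
    also have "\<dots> \<le> r / 2"
      by (rule P.op_norm_least) (use qs r in \<open>auto simp: dual_nspace_def subspace_nspace_def\<close>)
    finally have "ns_dist ramp_dual F (node_functional qs) < r" using r by simp
    then show ?thesis using F r node_functional_in by auto
  qed
  then have "M.mtopology closure_of range node_functional = ns_carrier ramp_dual"
    unfolding M.metric_closure_of using node_functional_in by auto
  then show ?thesis
    unfolding separable_space_def ns_topology_def
    using node_functional_in by (intro exI[of _ "range node_functional"]) auto
qed

section \<open>The quotient and the rank-one operator on it\<close>

abbreviation ramp_quotient :: "C01 set nspace" where
  "ramp_quotient \<equiv> quotient_nspace ramp_space"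

definition coset :: "C01 \<Rightarrow> C01 set" where
  "coset x = (+) x ` ramp_space"

text \<open>The choice of representative is harmless on cosets, as \<open>eval_0_coset\<close>
  shows.\<close>

definition eval_0 :: "C01 set \<Rightarrow> real" where
  "eval_0 A = (SOME a. a \<in> A) (unit_of_real 0)"

definition neg_eval_0 :: "C01 set \<Rightarrow> C01 set" where
  "neg_eval_0 A = coset (const_bcontfun (- eval_0 A))"

lemma closed_ramp_space: "closed ramp_space"
  by (simp add: ramp_space_def)

interpretation Q: normed_space_on ramp_quotient
  by (rule normed_space_on_quotient[OF subspace_ramp_space closed_ramp_space])

lemma mem_coset: "y \<in> coset x \<longleftrightarrow> y - x \<in> ramp_space"
  by (auto simp: coset_def image_iff algebra_simps intro!: bexI[of _ "y - x"])

lemma coset_self: "x \<in> coset x"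
  by (simp add: mem_coset subspace_0 subspace_ramp_space)

lemma coset_eq: "coset x = coset y" if "y - x \<in> ramp_space"
proof (intro set_eqI)
  fix u show "u \<in> coset x \<longleftrightarrow> u \<in> coset y"
    using that subspace_add[OF subspace_ramp_space, of "u - y" "y - x"]
      subspace_diff[OF subspace_ramp_space, of "u - x" "y - x"]
    by (auto simp: mem_coset)
qed

lemma quotient_carrier: "ns_carrier ramp_quotient = range coset"
  by (simp add: quotient_nspace_def coset_def)

lemma quotient_zero: "ns_zero ramp_quotient = coset 0"
  by (simp add: quotient_nspace_def coset_def)

lemma quotient_add: "ns_add ramp_quotient (coset x) (coset y) = coset (x + y)"
proof (intro set_eqI iffI)
  fix u assume "u \<in> ns_add ramp_quotient (coset x) (coset y)"
  then obtain a b where "u = a + b" "a \<in> coset x" "b \<in> coset y"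
    by (auto simp: quotient_nspace_def)
  then show "u \<in> coset (x + y)"
    using subspace_add[OF subspace_ramp_space, of "a - x" "b - y"]
    by (simp add: mem_coset algebra_simps)
next
  fix u assume "u \<in> coset (x + y)"
  then have "u = (u - y) + y" "u - y \<in> coset x" by (simp_all add: mem_coset algebra_simps)
  then show "u \<in> ns_add ramp_quotient (coset x) (coset y)"
    using coset_self[of y] unfolding quotient_nspace_def nspace.simps by blast
qed

lemma quotient_scale: "ns_scale ramp_quotient c (coset x) = coset (c *\<^sub>R x)"
proof (intro set_eqI iffI)
  fix u assume "u \<in> ns_scale ramp_quotient c (coset x)"
  then obtain a z where "u = c *\<^sub>R a + z" "a \<in> coset x" "z \<in> ramp_space"
    by (auto simp: quotient_nspace_def)
  then show "u \<in> coset (c *\<^sub>R x)"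
    using subspace_add[OF subspace_ramp_space subspace_scale[OF subspace_ramp_space], of "a - x" z c]
    by (simp add: mem_coset algebra_simps)
next
  fix u assume "u \<in> coset (c *\<^sub>R x)"
  then have "u = c *\<^sub>R x + (u - c *\<^sub>R x)" "u - c *\<^sub>R x \<in> ramp_space"
    by (simp_all add: mem_coset)
  then show "u \<in> ns_scale ramp_quotient c (coset x)"
    using coset_self[of x] unfolding quotient_nspace_def nspace.simps by blast
qed

lemma quotient_norm: "ns_norm ramp_quotient A = (INF a\<in>A. norm a)"
  by (simp add: quotient_nspace_def)

lemma quotient_norm_le: "a \<in> A \<Longrightarrow> ns_norm ramp_quotient A \<le> norm a"
  unfolding quotient_norm by (intro cINF_lower bdd_belowI2[of _ 0]) auto

text \<open>Two representatives differ by an element of \<open>ramp_space\<close>, which vanishes at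
  0.\<close>

lemma eval_0_coset: "eval_0 (coset x) = x (unit_of_real 0)" for x :: C01
proof -
  have "(SOME a. a \<in> coset x) \<in> coset x" using coset_self by (rule someI)
  then show ?thesis
    using ramp_space_zero[of "(SOME a. a \<in> coset x) - x"] by (simp add: eval_0_def mem_coset)
qed

lemma neg_eval_0_coset: "neg_eval_0 (coset x) = coset (const_bcontfun (- x (unit_of_real 0)))" for x :: C01
  by (simp add: neg_eval_0_def eval_0_coset)

lemma const_bcontfun_scale: "const_bcontfun (c :: real) = c *\<^sub>R const_bcontfun 1"
  by (rule bcontfun_eqI) simp

lemma coset_1_nonzero: "coset (const_bcontfun 1) \<noteq> ns_zero ramp_quotient"
proof
  assume "coset (const_bcontfun 1) = ns_zero ramp_quotient"
  then have "eval_0 (coset (const_bcontfun 1)) = eval_0 (coset 0)" by (simp add: quotient_zero)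
  then show False by (simp add: eval_0_coset)
qed

text \<open>All representatives share the value at 0, so its modulus is a lower bound for the norms
  in the infimum.\<close>

lemma eval_0_le_norm: "\<bar>x (unit_of_real 0)\<bar> \<le> ns_norm ramp_quotient (coset x)" for x :: C01
  unfolding quotient_norm
proof (rule cINF_greatest)
  fix a assume "a \<in> coset x"
  then have "a (unit_of_real 0) = x (unit_of_real 0)"
    using ramp_space_zero[of "a - x"] by (simp add: mem_coset)
  then show "\<bar>x (unit_of_real 0)\<bar> \<le> norm a"
    using norm_bounded[of a "unit_of_real 0"] by simp
qed (use coset_self in blast)

lemma norm_neg_eval_0: "ns_norm ramp_quotient (neg_eval_0 (coset x)) \<le> ns_norm ramp_quotient (coset x)" for x :: C01
proof -
  have "ns_norm ramp_quotient (neg_eval_0 (coset x)) \<le> norm (const_bcontfun (- x (unit_of_real 0)) :: C01)"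
    unfolding neg_eval_0_coset by (rule quotient_norm_le[OF coset_self])
  also have "\<dots> \<le> \<bar>x (unit_of_real 0)\<bar>"
    by (rule norm_bound) simp
  finally show ?thesis using eval_0_le_norm[of x] by simp
qed

lemma bounded_linear_neg_eval_0: "bounded_linear_on ramp_quotient ramp_quotient neg_eval_0"
  unfolding bounded_linear_on_def
proof (intro conjI)
  have *: "const_bcontfun (- (x + y)) = const_bcontfun (- x) + const_bcontfun (- y)"
    "const_bcontfun (- (c * x)) = c *\<^sub>R const_bcontfun (- x)" for x y c :: real
    by (auto intro!: bcontfun_eqI)
  show "\<forall>x\<in>ns_carrier ramp_quotient. neg_eval_0 x \<in> ns_carrier ramp_quotient"
    by (simp add: quotient_carrier neg_eval_0_def)
  show "\<forall>x\<in>ns_carrier ramp_quotient. \<forall>y\<in>ns_carrier ramp_quotient.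
      neg_eval_0 (ns_add ramp_quotient x y) = ns_add ramp_quotient (neg_eval_0 x) (neg_eval_0 y)"
    by (auto simp: quotient_carrier quotient_add neg_eval_0_coset * simp del: minus_add_distrib)
  show "\<forall>c. \<forall>x\<in>ns_carrier ramp_quotient.
      neg_eval_0 (ns_scale ramp_quotient c x) = ns_scale ramp_quotient c (neg_eval_0 x)"
    by (auto simp: quotient_carrier quotient_scale neg_eval_0_coset *)
  show "\<exists>K. \<forall>x\<in>ns_carrier ramp_quotient.
      ns_norm ramp_quotient (neg_eval_0 x) \<le> K * ns_norm ramp_quotient x"
    using norm_neg_eval_0 by (intro exI[of _ 1]) (auto simp: quotient_carrier)
qed

lemma rank_one_neg_eval_0: "rank_one ramp_quotient ramp_quotient neg_eval_0"
  unfolding rank_one_def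
proof (intro bexI conjI)
  let ?u = "coset (const_bcontfun 1)"
  have "neg_eval_0 ` ns_carrier ramp_quotient = range (\<lambda>x :: C01. coset (const_bcontfun (- x (unit_of_real 0))))"
    by (simp add: quotient_carrier neg_eval_0_coset image_image)
  also have "\<dots> = range (\<lambda>c. coset (const_bcontfun c))"
  proof -
    \<comment> \<open>Constant functions already attain every value at 0.\<close>
    have "range (\<lambda>x :: C01. - x (unit_of_real 0)) = UNIV"
      by (rule surjI[where f = "\<lambda>c. const_bcontfun (- c)"]) simp
    then show ?thesis by (metis (no_types) image_image)
  qed
  also have "\<dots> = range (\<lambda>c. ns_scale ramp_quotient c ?u)"
    by (simp add: quotient_scale flip: const_bcontfun_scale)
  finally show "neg_eval_0 ` ns_carrier ramp_quotient = range (\<lambda>c. ns_scale ramp_quotient c ?u)" .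
  show "?u \<noteq> ns_zero ramp_quotient" by (rule coset_1_nonzero)
  show "?u \<in> ns_carrier ramp_quotient" by (simp add: quotient_carrier)
qed

text \<open>The class of the constant 1 is nonzero, lies in the unit ball and is sent to its
  negative.\<close>

lemma op_norm_neg_eval_0_pos: "op_norm ramp_quotient ramp_quotient neg_eval_0 > 0"
proof -
  let ?u = "coset (const_bcontfun 1)"
  have u: "?u \<in> ns_carrier ramp_quotient" by (simp add: quotient_carrier)
  have "0 < ns_norm ramp_quotient ?u"
    using Q.norm_nonneg[OF u] Q.norm_eq_0[OF u] coset_1_nonzero by simp
  also have "\<dots> = ns_norm ramp_quotient (neg_eval_0 ?u)"
  proof -
    have "neg_eval_0 ?u = ns_scale ramp_quotient (- 1) ?u"
      by (simp add: neg_eval_0_coset quotient_scale const_bcontfun_scale[of "- 1"])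
    then show ?thesis using Q.norm_scale[OF u, of "- 1"] by simp
  qed
  also have "\<dots> \<le> op_norm ramp_quotient ramp_quotient neg_eval_0"
    unfolding op_norm_def
  proof (rule cSUP_upper)
    have "ns_norm ramp_quotient ?u \<le> norm (const_bcontfun 1 :: C01)"
      by (rule quotient_norm_le[OF coset_self])
    also have "\<dots> \<le> 1" by (rule norm_bound) simp
    finally show "?u \<in> {x \<in> ns_carrier ramp_quotient. ns_norm ramp_quotient x \<le> 1}" using u by simp
    show "bdd_above ((\<lambda>x. ns_norm ramp_quotient (neg_eval_0 x))
        ` {x \<in> ns_carrier ramp_quotient. ns_norm ramp_quotient x \<le> 1})"
      using norm_neg_eval_0 order.trans by (intro bdd_aboveI2[of _ _ 1]) (fastforce simp: quotient_carrier)
  qed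
  finally show ?thesis .
qed

section \<open>Failure of the Daugavet equation\<close>

lemma norm_recentred_le:
  fixes a :: C01
  assumes e: "e > 0"
  shows "\<exists>N. norm (a - const_bcontfun (a (unit_of_real 0)) + a (unit_of_real 0) *\<^sub>R ramp N) \<le> norm a + e"
proof -
  let ?o = "unit_of_real 0"
  have "isCont a ?o"
    by (rule continuous_on_interior[of UNIV]) simp_all
  then obtain d where d: "d > 0" "\<And>s. dist s ?o < d \<Longrightarrow> dist (a s) (a ?o) < e"
    using e unfolding continuous_at_eps_delta by blast
  \<comment> \<open>The ramp then reaches 1 within distance \<open>d\<close> of 0, where
    \<open>a\<close> is still \<open>e\<close>-close to its value at 0.\<close>
  obtain N where N: "(1/2) ^ N < d / 2"
    using real_arch_pow_inv[of "d / 2" "1 / 2"] d by auto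
  have b: "\<bar>a s\<bar> \<le> norm a" for s using norm_bounded[of a s] by simp
  have "norm (a - const_bcontfun (a ?o) + a ?o *\<^sub>R ramp N) \<le> norm a + e"
  proof (rule norm_bound)
    fix s
    \<comment> \<open>Where the ramp is 1, the two corrections cancel and \<open>a s\<close>
      remains. Elsewhere \<open>a s - a ?o\<close> is below \<open>e\<close> in modulus, and the
      ramp term is at most \<open>norm a\<close>.\<close>
    show "norm ((a - const_bcontfun (a ?o) + a ?o *\<^sub>R ramp N) s) \<le> norm a + e"
    proof (cases "2 \<le> 2 ^ N * real_of_unit s")
      case True
      then show ?thesis using b[of s] e by (simp add: ramp_eq_1)
    next
      case False
      then have "real_of_unit s < 2 * (1/2) ^ N" by (simp add: field_simps)
      then have "dist s ?o < d"
        using N real_of_unit_bounds[of s]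
        by (simp add: dist_unit_interval_def unit_of_real_inverse dist_real_def)
      then have "\<bar>a s - a ?o\<bar> < e" using d(2) by (simp add: dist_real_def)
      moreover have "\<bar>a ?o * ramp N s\<bar> \<le> norm a * 1"
        unfolding abs_mult using b ramp_bounds by (intro mult_mono) auto
      ultimately show ?thesis by simp
    qed
  qed
  then show ?thesis by blast
qed

lemma not_daugavet_ramp_quotient: "\<not> daugavet_property ramp_quotient"
proof
  let ?S = "\<lambda>x. ns_add ramp_quotient x (neg_eval_0 x)"
  assume "daugavet_property ramp_quotient"
  then have "op_norm ramp_quotient ramp_quotient ?S = 1 + op_norm ramp_quotient ramp_quotient neg_eval_0"
    using bounded_linear_neg_eval_0 rank_one_neg_eval_0 by (simp add: daugavet_property_def)
  moreover have "op_norm ramp_quotient ramp_quotient ?S \<le> 1"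
    unfolding op_norm_def
  proof (rule cSUP_least)
    show "{x \<in> ns_carrier ramp_quotient. ns_norm ramp_quotient x \<le> 1} \<noteq> {}"
      using Q.zero_closed Q.norm_eq_0[OF Q.zero_closed] by force
    fix A assume "A \<in> {x \<in> ns_carrier ramp_quotient. ns_norm ramp_quotient x \<le> 1}"
    then obtain x where x: "A = coset x" "ns_norm ramp_quotient A \<le> 1"
      by (auto simp: quotient_carrier)
    show "ns_norm ramp_quotient (?S A) \<le> 1"
    proof (rule field_le_epsilon)
      fix e :: real assume e: "e > 0"
      \<comment> \<open>The infimum need not be attained, so a nearly optimal representative is
        taken; the other \<open>e / 2\<close> goes to recentring it.\<close>
      have "(INF a\<in>A. norm a) < 1 + e / 2" using x e by (simp add: quotient_norm)
      then obtain a where a: "a \<in> A" "norm a < 1 + e / 2"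
        using coset_self[of x] x(1) by (subst (asm) cINF_less_iff) (auto intro: bdd_belowI2[of _ 0])
      have A: "A = coset a" using a(1) x(1) coset_eq by (simp add: mem_coset)
      let ?c = "a (unit_of_real 0)"
      obtain N where N: "norm (a - const_bcontfun ?c + ?c *\<^sub>R ramp N) \<le> norm a + e / 2"
        using norm_recentred_le[of "e / 2" a] e by auto
      \<comment> \<open>Adding a multiple of a ramp does not change the coset, so the recentred
        function represents \<open>?S A\<close>.\<close>
      have "a - const_bcontfun ?c + ?c *\<^sub>R ramp N \<in> ?S A"
      proof -
        have "const_bcontfun (- ?c) = - (const_bcontfun ?c :: C01)" by (auto intro!: bcontfun_eqI)
        then show ?thesis
          by (simp add: A neg_eval_0_coset quotient_add mem_coset subspace_scale subspace_ramp_space ramp_in)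
      qed
      from quotient_norm_le[OF this] N a(2) show "ns_norm ramp_quotient (?S A) \<le> 1 + e" by simp
    qed
  qed
  ultimately show False using op_norm_neg_eval_0_pos by simp
qed

theorem corollary3p4:
  shows "\<exists>Z :: C01 set. subspace Z \<and> closed Z \<and>
           separable_space (ns_topology (dual_nspace (subspace_nspace Z))) \<and>
           \<not> daugavet_property (quotient_nspace Z)"
  by (intro exI[of _ ramp_space] conjI subspace_ramp_space closed_ramp_space separable_ramp_dual
      not_daugavet_ramp_quotient)

end
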